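(* Let $D$ be a division algebra over a field $k$ and let $E$ be a division subalgebra of $D$. If $D$ is finite-dimensional both as a left and as a right $E$-vector space, then $\mathrm{Ld}^*(D)\le \mathrm{Ld}^*(E)$.
   Context: Division subalgebras are over $k$. A subframe of a $k$-algebra $A$ is a finite-dimensional $k$-subspace of $A$ containing $1$. For a $k$-algebra $A$ that is a domain and a subframe $V$ of $A$, $\mathrm{VDI}^*(V)\in[0,\infty]$ is the supremum of all real $d>0$ for which there is a constant $C>0$ with $\max(\dim_k(VW),\dim_k(WV))\ge \dim_k(W)+C\,(\dim_k W)^{(d-1)/d}$ for every subframe $W$ of $A$ (and $0$ if there is no such $d$). The strong lower transcendence degree is $\mathrm{Ld}^*(A)=\sup_V\mathrm{VDI}^*(V)$ over all subframes $V$ of $A$. Here $VW$ is the $k$-span of the products $vw$. *)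

theory Defs
  imports Complex_Main "HOL-Library.Extended_Nonnegative_Real"
begin

(* Unital associative algebras over a field; the ring is not assumed commutative. *)

locale k_algebra = vector_space scale
  for scale :: "'k::field \<Rightarrow> 'a::ring_1 \<Rightarrow> 'a" (infixr \<open>*s\<close> 75) +
  assumes mult_scale_left: "(c *s x) * y = c *s (x * y)"
    and mult_scale_right: "x * (c *s y) = c *s (x * y)"
begin

(* Below, the algebra A is given by its carrier, a k-subalgebra of the ambient type;
   A = UNIV is the ambient algebra itself. For subsets of A, the k-span and k-dimension
   taken in the ambient algebra are those taken in A. *)

definition subframe :: "'a set \<Rightarrow> 'a set \<Rightarrow> bool" where
  "subframe A V \<longleftrightarrow>
     V \<subseteq> A \<and> subspace V \<and> (\<exists>B. finite B \<and> span B = V) \<and> 1 \<in> V"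

definition span_prod :: "'a set \<Rightarrow> 'a set \<Rightarrow> 'a set" where
  "span_prod V W = span {v * w |v w. v \<in> V \<and> w \<in> W}"

(* In ennreal the supremum of the empty set is 0. *)

definition VDI_star :: "'a set \<Rightarrow> 'a set \<Rightarrow> ennreal" where
  "VDI_star A V = Sup {ennreal d |d. d > 0 \<and>
     (\<exists>C>0. \<forall>W. subframe A W \<longrightarrow>
        real (max (dim (span_prod V W)) (dim (span_prod W V)))
          \<ge> real (dim W) + C * real (dim W) powr ((d - 1) / d))}"

definition Ld_star :: "'a set \<Rightarrow> ennreal" where
  "Ld_star A = Sup {VDI_star A V |V. subframe A V}"

end

definition division_subalgebra :: "('k::field \<Rightarrow> 'a::division_ring \<Rightarrow> 'a) \<Rightarrow> 'a set \<Rightarrow> bool" where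
  "division_subalgebra scale E \<longleftrightarrow>
     module.subspace scale E \<and> 1 \<in> E \<and> (\<forall>x\<in>E. \<forall>y\<in>E. x * y \<in> E) \<and>
     (\<forall>x\<in>E. x \<noteq> 0 \<longrightarrow> inverse x \<in> E)"

(* The library's vector_space locale only covers commutative scalars, so
   finite-dimensionality over the division ring E is stated as the existence of a
   finite spanning set, with the scalars acting from the indicated side. *)

definition left_finite_dimensional :: "'a::division_ring set \<Rightarrow> bool" where
  "left_finite_dimensional E \<longleftrightarrow>
     (\<exists>B. finite B \<and> (\<forall>x. \<exists>c. (\<forall>b\<in>B. c b \<in> E) \<and> x = (\<Sum>b\<in>B. c b * b)))"

definition right_finite_dimensional :: "'a::division_ring set \<Rightarrow> bool" where
  "right_finite_dimensional E \<longleftrightarrow>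
     (\<exists>B. finite B \<and> (\<forall>x. \<exists>c. (\<forall>b\<in>B. c b \<in> E) \<and> x = (\<Sum>b\<in>B. b * c b)))"

end

theory Submission
  imports Defs
begin

text \<open>
  Write \<open>XY\<close> for \<open>span_prod X Y\<close>; it makes sense for arbitrary subsets and is associative and
  monotone. Let the finite sets \<open>L\<close> and \<open>R\<close>, both containing \<open>1\<close>, span \<open>D\<close> as a right and as a
  left \<open>E\<close>-space, so that \<open>D = LE = ER\<close>. Fix a subframe \<open>V\<close> of \<open>D\<close>. Since \<open>VL\<close> and \<open>RV\<close> are
  finite-dimensional, only finitely many coefficients from \<open>E\<close> are needed to express them, and
  a single subframe \<open>V'\<close> of \<open>E\<close> satisfies
  \<open>VL \<subseteq> LV'\<close> and \<open>RV \<subseteq> V'R\<close> (\<open>subframe_of_coefficients\<close>).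

  A subframe \<open>W\<close> of \<open>E\<close> is tested in \<open>D\<close> through the two-sided thickening \<open>LWR\<close>, which controls
  multiplication from both sides at once:
  \<open>V(LWR) \<subseteq> L(V'W)R\<close> and \<open>(LWR)V \<subseteq> L(WV')R\<close>.
  There is no reason for \<open>LWR\<close> to have dimension \<open>card L * card R * dim W\<close>, but only the growth
  matters: for \<open>W \<subseteq> X\<close>, the quotient of \<open>LXR\<close> by \<open>LWR\<close> is spanned by \<open>card L * card R\<close> images of
  the quotient of \<open>X\<close> by \<open>W\<close> (\<open>dim_thickening_growth\<close>). Hence the growth of \<open>LWR\<close> under \<open>V\<close> is at
  most \<open>card L * card R\<close> times the growth of \<open>W\<close> under \<open>V'\<close>. As \<open>dim (LWR)\<close> lies between \<open>dim W\<close>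
  and \<open>card L * card R * dim W\<close>, an isoperimetric inequality of exponent \<open>d\<close> for \<open>V\<close> in \<open>D\<close>
  becomes one of the same exponent for \<open>V'\<close> in \<open>E\<close>, with a smaller constant.
\<close>

section \<open>Dimension of finitely spanned subspaces\<close>

context vector_space
begin

lemma span_Un_span_right: "span (A \<union> span B) = span (A \<union> B)"
proof (rule span_subspace)
  show "A \<union> span B \<subseteq> span (A \<union> B)"
    using span_superset[of "A \<union> B"] span_mono[of B "A \<union> B"] by blast
  show "span (A \<union> B) \<subseteq> span (A \<union> span B)"
    by (intro span_mono Un_mono order_refl span_superset)
qed (rule subspace_span)

lemma span_Un_span_left: "span (span A \<union> B) = span (A \<union> B)"
  using span_Un_span_right[of B A] by (simp only: Un_commute)

lemma dim_mono_finitely_spanned: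
  assumes "U \<subseteq> span T" "T \<subseteq> span S" "finite S"
  shows "dim U \<le> dim T"
proof -
  obtain B where B: "B \<subseteq> T" "independent B" "T \<subseteq> span B" "card B = dim T"
    by (rule basis_exists)
  have "finite B"
    using independent_span_bound[OF assms(3) B(2)] B(1) assms(2) by blast
  moreover have "U \<subseteq> span B"
    using assms(1) span_minimal[OF B(3)] by auto
  ultimately show ?thesis
    using dim_le_card B(4) by metis
qed

lemma finitely_spanned_complement:
  assumes "W \<subseteq> X" "X \<subseteq> span S" "finite S"
  obtains K where "finite K" "X \<subseteq> span (W \<union> K)" "dim W + card K = dim X"
proof -
  obtain B where B: "B \<subseteq> W" "independent B" "W \<subseteq> span B" "card B = dim W"
    by (rule basis_exists)
  obtain B' where B': "B \<subseteq> B'" "B' \<subseteq> X" "independent B'" "X \<subseteq> span B'"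
    using maximal_independent_subset_extend[OF subset_trans[OF B(1) assms(1)] B(2)] .
  have fin: "finite B'"
    using independent_span_bound[OF assms(3) B'(3)] B'(2) assms(2) by blast
  show thesis
  proof (rule that[of "B' - B"])
    have "B' \<subseteq> W \<union> (B' - B)"
      using B(1) by blast
    then show "X \<subseteq> span (W \<union> (B' - B))"
      using B'(4) by (meson span_mono subset_trans)
    have "card B' = dim X"
      using B'(2,4,3) by (rule basis_card_eq_dim)
    moreover have "card B + card (B' - B) = card B'"
      using card_Diff_subset[of B B'] card_mono[OF fin B'(1)] finite_subset[OF B'(1) fin] B'(1)
      by simp
    ultimately show "dim W + card (B' - B) = dim X"
      using B(4) by simp
  qed (simp add: fin)
qed

lemma dim_Un_finite_le:
  assumes "U \<subseteq> span S" "finite S" "finite K"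
  shows "dim (U \<union> K) \<le> dim U + card K"
proof -
  obtain B where B: "B \<subseteq> U" "independent B" "U \<subseteq> span B" "card B = dim U"
    by (rule basis_exists)
  have "finite B"
    using independent_span_bound[OF assms(2) B(2)] B(1) assms(1) by blast
  moreover have "U \<subseteq> span (B \<union> K)" "K \<subseteq> span (B \<union> K)"
    using subset_trans[OF B(3) span_mono[of B "B \<union> K"]] span_superset[of "B \<union> K"] by auto
  ultimately have "dim (U \<union> K) \<le> card (B \<union> K)"
    using assms(3) by (intro dim_le_card) auto
  also have "\<dots> \<le> dim U + card K"
    using card_Un_le B(4) by metis
  finally show ?thesis .
qed

lemma finite_subset_span_finite:
  assumes "finite F" "F \<subseteq> span S"
  obtains S' where "finite S'" "S' \<subseteq> S" "F \<subseteq> span S'"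
proof -
  have "\<exists>S'. finite S' \<and> S' \<subseteq> S \<and> F \<subseteq> span S'"
    using assms
  proof (induction F rule: finite_induct)
    case empty
    then show ?case by auto
  next
    case (insert x F)
    then obtain S' where S': "finite S'" "S' \<subseteq> S" "F \<subseteq> span S'"
      by auto
    from insert.prems obtain T r where "finite T" "T \<subseteq> S" "x = (\<Sum>a\<in>T. r a *s a)"
      unfolding span_explicit by blast
    moreover from this have "x \<in> span T"
      by (auto intro: span_sum span_scale span_base)
    ultimately show ?case
      using S' span_mono[of T "S' \<union> T"] span_mono[of S' "S' \<union> T"]
      by (intro exI[of _ "S' \<union> T"]) auto
  qed
  then show thesis
    using that by blast
qed

end

section \<open>Products of subspaces\<close>

context k_algebra
begin

lemma span_prodI: "x \<in> X \<Longrightarrow> y \<in> Y \<Longrightarrow> x * y \<in> span_prod X Y"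
  unfolding span_prod_def by (rule span_base) blast

lemma subspace_span_prod: "subspace (span_prod X Y)"
  unfolding span_prod_def by simp

lemma span_prod_least:
  assumes "subspace T" "\<And>x y. x \<in> X \<Longrightarrow> y \<in> Y \<Longrightarrow> x * y \<in> T"
  shows "span_prod X Y \<subseteq> T"
  unfolding span_prod_def using assms by (intro span_minimal) auto

lemma span_prod_mono: "X \<subseteq> X' \<Longrightarrow> Y \<subseteq> Y' \<Longrightarrow> span_prod X Y \<subseteq> span_prod X' Y'"
  by (rule span_prod_least[OF subspace_span_prod]) (auto intro: span_prodI)

lemma subspace_mult_left_preimage: "subspace T \<Longrightarrow> subspace {y. x * y \<in> T}"
  by (auto simp: subspace_def distrib_left mult_scale_right)

lemma subspace_mult_right_preimage: "subspace T \<Longrightarrow> subspace {x. x * y \<in> T}"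
  by (auto simp: subspace_def distrib_right mult_scale_left)

lemma span_prod_span_left: "span_prod (span X) Y = span_prod X Y"
proof
  have "x * y \<in> span_prod X Y" if "x \<in> span X" "y \<in> Y" for x y
    using span_minimal[OF _ subspace_mult_right_preimage[OF subspace_span_prod[of X Y]], of X y] that
    by (auto intro: span_prodI)
  then show "span_prod (span X) Y \<subseteq> span_prod X Y"
    by (rule span_prod_least[OF subspace_span_prod])
qed (simp add: span_prod_mono span_superset)

lemma span_prod_span_right: "span_prod X (span Y) = span_prod X Y"
proof
  have "x * y \<in> span_prod X Y" if "x \<in> X" "y \<in> span Y" for x y
    using span_minimal[OF _ subspace_mult_left_preimage[OF subspace_span_prod[of X Y]], of Y x] that
    by (auto intro: span_prodI)
  then show "span_prod X (span Y) \<subseteq> span_prod X Y"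
    by (rule span_prod_least[OF subspace_span_prod])
qed (simp add: span_prod_mono span_superset)

lemma span_prod_assoc: "span_prod (span_prod X Y) Z = span_prod X (span_prod Y Z)"
proof
  have "x * y * z \<in> span_prod X (span_prod Y Z)" if "x \<in> X" "y \<in> Y" "z \<in> Z" for x y z
    unfolding mult.assoc by (intro span_prodI that)
  then have "span_prod {x * y |x y. x \<in> X \<and> y \<in> Y} Z \<subseteq> span_prod X (span_prod Y Z)"
    by (intro span_prod_least[OF subspace_span_prod]) blast
  then show "span_prod (span_prod X Y) Z \<subseteq> span_prod X (span_prod Y Z)"
    by (simp only: span_prod_def[of X Y] span_prod_span_left)
  have "x * (y * z) \<in> span_prod (span_prod X Y) Z" if "x \<in> X" "y \<in> Y" "z \<in> Z" for x y z
    unfolding mult.assoc[symmetric] by (intro span_prodI that)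
  then have "span_prod X {y * z |y z. y \<in> Y \<and> z \<in> Z} \<subseteq> span_prod (span_prod X Y) Z"
    by (intro span_prod_least[OF subspace_span_prod]) blast
  then show "span_prod X (span_prod Y Z) \<subseteq> span_prod (span_prod X Y) Z"
    by (simp only: span_prod_def[of Y Z] span_prod_span_right)
qed

lemma span_prod_contains_left: "1 \<in> Y \<Longrightarrow> X \<subseteq> span_prod X Y"
  using span_prodI[of _ X 1 Y] by auto

lemma span_prod_contains_right: "1 \<in> X \<Longrightarrow> Y \<subseteq> span_prod X Y"
  using span_prodI[of 1 X _ Y] by auto

lemma span_prod_eq_span_products: "span_prod X Y = span ((\<lambda>(x, y). x * y) ` (X \<times> Y))"
  unfolding span_prod_def by (rule arg_cong[where f = span]) auto

text \<open>
  An element of \<open>XY\<close> is a combination of finitely many products. Applied to \<open>D = LE\<close> and \<open>D = ER\<close>,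
  this shows that finitely many elements of \<open>D\<close> involve only finitely many coefficients from \<open>E\<close>.
\<close>

lemma span_prod_finite_support:
  assumes "finite P" "P \<subseteq> span_prod X Y"
  obtains X' Y' where "finite X'" "X' \<subseteq> X" "finite Y'" "Y' \<subseteq> Y" "P \<subseteq> span_prod X' Y'"
proof -
  obtain S where S: "finite S" "S \<subseteq> (\<lambda>(x, y). x * y) ` (X \<times> Y)" "P \<subseteq> span S"
    using finite_subset_span_finite assms unfolding span_prod_eq_span_products by metis
  obtain Q where Q: "finite Q" "Q \<subseteq> X \<times> Y" "S = (\<lambda>(x, y). x * y) ` Q"
    using finite_subset_image[OF S(1,2)] by blast
  have "S \<subseteq> span_prod (fst ` Q) (snd ` Q)"
    unfolding Q(3) by (force intro: span_prodI)
  then have "P \<subseteq> span_prod (fst ` Q) (snd ` Q)"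
    using S(3) span_minimal[OF _ subspace_span_prod] by blast
  with Q show thesis
    by (intro that[of "fst ` Q" "snd ` Q"]) auto
qed

lemma span_prod_finitely_spanned:
  assumes "finite F" "finite G"
  obtains S where "finite S" "span_prod (span F) (span G) = span S"
  using assms that[of "(\<lambda>(x, y). x * y) ` (F \<times> G)"]
  by (simp add: span_prod_span_left span_prod_span_right flip: span_prod_eq_span_products)

lemma span_prod_Un_right: "span_prod X (Y \<union> Z) = span (span_prod X Y \<union> span_prod X Z)"
  unfolding span_prod_eq_span_products span_Un_span_left span_Un_span_right
    Sigma_Un_distrib2 image_Un ..

lemma span_prod_Un_left: "span_prod (X \<union> Y) Z = span (span_prod X Z \<union> span_prod Y Z)"
  unfolding span_prod_eq_span_products span_Un_span_left span_Un_span_right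
    Sigma_Un_distrib1 image_Un ..

section \<open>Two-sided thickenings\<close>

definition thickening :: "'a set \<Rightarrow> 'a set \<Rightarrow> 'a set \<Rightarrow> 'a set" where
  "thickening L R W = span_prod (span_prod L W) R"

lemma thickening_mono: "W \<subseteq> X \<Longrightarrow> thickening L R W \<subseteq> thickening L R X"
  unfolding thickening_def by (intro span_prod_mono) auto

lemma thickening_contains: "1 \<in> L \<Longrightarrow> 1 \<in> R \<Longrightarrow> W \<subseteq> thickening L R W"
  unfolding thickening_def
  using span_prod_contains_left span_prod_contains_right by (metis subset_trans)

lemma thickening_span: "thickening L R (span W) = thickening L R W"
  unfolding thickening_def by (simp add: span_prod_span_right)

lemma thickening_Un: "thickening L R (W \<union> X) = span (thickening L R W \<union> thickening L R X)"
  unfolding thickening_def by (simp add: span_prod_Un_right span_prod_span_left span_prod_Un_left)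

lemma thickening_finite:
  assumes "finite L" "finite R" "finite K"
  obtains H where "finite H" "card H \<le> card L * card R * card K" "thickening L R K = span H"
proof
  let ?H = "(\<lambda>(p, r). p * r) ` ((\<lambda>(l, k). l * k) ` (L \<times> K) \<times> R)"
  show "finite ?H"
    using assms by simp
  have "card ?H \<le> card ((\<lambda>(l, k). l * k) ` (L \<times> K)) * card R"
    unfolding card_cartesian_product[symmetric] using assms by (intro card_image_le) simp
  also have "\<dots> \<le> card (L \<times> K) * card R"
    using card_image_le[of "L \<times> K"] assms by (intro mult_right_mono) auto
  finally show "card ?H \<le> card L * card R * card K"
    by (simp add: card_cartesian_product mult_ac)
  show "thickening L R K = span ?H"
    unfolding thickening_def span_prod_eq_span_products[of L K] span_prod_span_left
    by (rule span_prod_eq_span_products)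
qed

text \<open>
  A complement of \<open>W\<close> in \<open>X\<close> with basis \<open>K\<close> contributes to the thickening at most the span of the
  products \<open>l * k * r\<close>, however far these are from being independent.
\<close>

lemma dim_thickening_growth:
  assumes "finite L" "finite R" "W \<subseteq> X" "finite S" "X \<subseteq> span S"
  shows "dim (thickening L R X) \<le> dim (thickening L R W) + card L * card R * (dim X - dim W)"
proof -
  obtain K where K: "finite K" "X \<subseteq> span (W \<union> K)" "dim W + card K = dim X"
    using finitely_spanned_complement[OF assms(3,5,4)] by metis
  obtain H where H: "finite H" "card H \<le> card L * card R * card K" "thickening L R K = span H"
    using thickening_finite[OF assms(1,2) K(1)] by metis
  obtain G where G: "finite G" "thickening L R S = span G"
    using thickening_finite[OF assms(1,2,4)] by metis
  have W: "thickening L R W \<subseteq> span G"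
    using thickening_mono[of W "span S" L R] assms(3,5) G(2) thickening_span by auto
  have GH: "thickening L R W \<union> H \<subseteq> span (G \<union> H)"
    using W span_mono[of G "G \<union> H"] span_superset[of "G \<union> H"] by blast
  have "thickening L R X \<subseteq> thickening L R (W \<union> K)"
    using thickening_mono[OF K(2)] thickening_span by metis
  also have "\<dots> = span (thickening L R W \<union> H)"
    by (simp only: thickening_Un H(3) span_Un_span_right)
  finally have "dim (thickening L R X) \<le> dim (thickening L R W \<union> H)"
    by (rule dim_mono_finitely_spanned[of _ _ "G \<union> H"])
      (use GH G(1) H(1) in simp_all)
  also have "\<dots> \<le> dim (thickening L R W) + card H"
    using dim_Un_finite_le[OF W G(1) H(1)] .
  also have "card H \<le> card L * card R * (dim X - dim W)"
    using H(2) unfolding K(3)[symmetric] by simp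
  finally show ?thesis
    by simp
qed

lemma dim_thickening_le:
  assumes "finite L" "finite R" "finite S" "W \<subseteq> span S"
  shows "dim (thickening L R W) \<le> card L * card R * dim W"
proof -
  obtain K where K: "finite K" "W \<subseteq> span K" "card K = dim W"
  proof -
    obtain K where "finite K" "W \<subseteq> span ({} \<union> K)" "dim {} + card K = dim W"
      by (rule finitely_spanned_complement[OF empty_subsetI assms(4,3)])
    moreover have "dim {} = 0"
      using dim_eq_card_independent[OF independent_empty] by simp
    ultimately show thesis
      by (intro that[of K]) simp_all
  qed
  obtain H where H: "finite H" "card H \<le> card L * card R * card K" "thickening L R K = span H"
    using thickening_finite[OF assms(1,2) K(1)] by metis
  have "thickening L R W \<subseteq> span H"
    using thickening_mono[OF K(2)] thickening_span H(3) by metis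
  then have "dim (thickening L R W) \<le> card H"
    using H(1) by (rule dim_le_card)
  then show ?thesis
    using H(2) K(3) by simp
qed

section \<open>Descent of the isoperimetric inequality\<close>

text \<open>
  The elements of \<open>VL\<close> and \<open>RV\<close> are expressed over the spanning sets \<open>L\<close> and \<open>R\<close>, and \<open>V'\<close> is
  generated by \<open>1\<close> and the coefficients of generators of both spaces.
  One subframe serves both sides because enlarging \<open>V'\<close> preserves either inclusion.
\<close>

lemma subframe_of_coefficients:
  assumes E: "subspace E" "1 \<in> E"
    and L: "finite L" "span_prod L E = UNIV"
    and R: "finite R" "span_prod E R = UNIV"
    and V: "subframe UNIV V"
  obtains V' where "subframe E V'" "span_prod V L \<subseteq> span_prod L V'"
    "span_prod R V \<subseteq> span_prod V' R"
proof -
  obtain F where F: "finite F" "V = span F"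
    using V unfolding subframe_def by blast
  let ?P = "(\<lambda>(x, y). x * y) ` (F \<times> L)" and ?Q = "(\<lambda>(x, y). x * y) ` (R \<times> F)"
  have "finite ?P" "?P \<subseteq> span_prod L E" "finite ?Q" "?Q \<subseteq> span_prod E R"
    using F(1) L R by simp_all
  then obtain L' C C' R' where
    C: "L' \<subseteq> L" "finite C" "C \<subseteq> E" "?P \<subseteq> span_prod L' C" and
    C': "R' \<subseteq> R" "finite C'" "C' \<subseteq> E" "?Q \<subseteq> span_prod C' R'"
    using span_prod_finite_support[of ?P L E] span_prod_finite_support[of ?Q E R] by metis
  define V' where "V' = span (insert 1 (C \<union> C'))"
  show thesis
  proof
    show "subframe E V'"
      unfolding subframe_def
    proof (intro conjI)
      show "V' \<subseteq> E"
        unfolding V'_def using E C(3) C'(3) by (simp add: span_minimal)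
      show "\<exists>B. finite B \<and> span B = V'"
        unfolding V'_def using C(2) C'(2) by (intro exI[of _ "insert 1 (C \<union> C')"]) simp
      show "1 \<in> V'"
        unfolding V'_def by (simp add: span_base)
    qed (simp add: V'_def)
    have CV: "C \<subseteq> V'" "C' \<subseteq> V'"
      unfolding V'_def using span_superset[of "insert 1 (C \<union> C')"] by simp_all
    have "?P \<subseteq> span_prod L V'"
      by (rule subset_trans[OF C(4) span_prod_mono[OF C(1) CV(1)]])
    moreover have "?Q \<subseteq> span_prod V' R"
      by (rule subset_trans[OF C'(4) span_prod_mono[OF CV(2) C'(1)]])
    ultimately have "span ?P \<subseteq> span_prod L V'" "span ?Q \<subseteq> span_prod V' R"
      by (simp_all add: span_minimal subspace_span_prod)
    then show "span_prod V L \<subseteq> span_prod L V'" "span_prod R V \<subseteq> span_prod V' R"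
      unfolding F(2) span_prod_span_left span_prod_span_right
        span_prod_eq_span_products[of F L] span_prod_eq_span_products[of R F] .
  qed
qed

text \<open>
  Associativity moves \<open>V\<close> past \<open>L\<close>, or past \<open>R\<close>, next to \<open>W\<close>, where it has turned into \<open>V'\<close>.
  Since \<open>1 \<in> V'\<close>, the products \<open>V'W\<close> and \<open>WV'\<close> contain \<open>W\<close>, so \<open>dim_thickening_growth\<close> applies.
\<close>

lemma dim_thickening_product_growth:
  assumes fin: "finite L" "finite R"
    and V': "subframe E V'"
    and W: "subframe E W"
    and VL: "span_prod V L \<subseteq> span_prod L V'"
    and RV: "span_prod R V \<subseteq> span_prod V' R"
  shows "dim (span_prod V (thickening L R W))
      \<le> dim (thickening L R W) + card L * card R * (dim (span_prod V' W) - dim W)"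
    and "dim (span_prod (thickening L R W) V)
      \<le> dim (thickening L R W) + card L * card R * (dim (span_prod W V') - dim W)"
proof -
  obtain F G where F: "finite F" "V' = span F" and G: "finite G" "W = span G"
    using V' W unfolding subframe_def by metis
  obtain S where S: "finite S" "span_prod V' W = span S"
    unfolding F(2) G(2) using span_prod_finitely_spanned[OF F(1) G(1)] .
  obtain S' where S': "finite S'" "span_prod W V' = span S'"
    unfolding F(2) G(2) using span_prod_finitely_spanned[OF G(1) F(1)] .
  have one: "1 \<in> V'"
    using V' unfolding subframe_def by blast
  have growth: "dim U \<le> dim (thickening L R W) + card L * card R * (dim X - dim W)"
    if U: "U \<subseteq> thickening L R X" and X: "W \<subseteq> X" "finite S" "X = span S" for U X S
  proof -
    obtain H where H: "finite H" "thickening L R S = span H"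
      using thickening_finite[OF fin X(2)] by metis
    have "thickening L R X = span H"
      unfolding X(3) thickening_span by (fact H(2))
    then have "dim U \<le> dim (thickening L R X)"
      using U H(1) by (intro dim_mono_finitely_spanned[of _ _ H]) (simp_all add: span_span)
    also have "\<dots> \<le> dim (thickening L R W) + card L * card R * (dim X - dim W)"
      using X by (intro dim_thickening_growth[OF fin, of _ _ S]) simp_all
    finally show ?thesis .
  qed
  have "span_prod V (thickening L R W) = span_prod (span_prod (span_prod V L) W) R"
    by (simp add: thickening_def span_prod_assoc)
  also have "\<dots> \<subseteq> span_prod (span_prod (span_prod L V') W) R"
    by (intro span_prod_mono[OF span_prod_mono[OF VL]] order_refl)
  also have "\<dots> = thickening L R (span_prod V' W)"
    by (simp add: thickening_def span_prod_assoc)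
  finally show "dim (span_prod V (thickening L R W))
      \<le> dim (thickening L R W) + card L * card R * (dim (span_prod V' W) - dim W)"
    by (rule growth[OF _ span_prod_contains_right[OF one] S(1,2)])
  have "span_prod (thickening L R W) V = span_prod (span_prod L W) (span_prod R V)"
    by (simp add: thickening_def span_prod_assoc)
  also have "\<dots> \<subseteq> span_prod (span_prod L W) (span_prod V' R)"
    by (intro span_prod_mono[OF _ RV] order_refl)
  also have "\<dots> = thickening L R (span_prod W V')"
    by (simp add: thickening_def span_prod_assoc)
  finally show "dim (span_prod (thickening L R W) V)
      \<le> dim (thickening L R W) + card L * card R * (dim (span_prod W V') - dim W)"
    by (rule growth[OF _ span_prod_contains_left[OF one] S'(1,2)])
qed

lemma subframe_thickening:
  assumes "finite L" "finite R" "1 \<in> L" "1 \<in> R" "subframe E W"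
  shows "subframe UNIV (thickening L R W)"
proof -
  obtain G where G: "finite G" "W = span G"
    using assms(5) unfolding subframe_def by metis
  obtain H where "finite H" "thickening L R W = span H"
    using thickening_finite[OF assms(1,2) G(1)] thickening_span G(2) by metis
  moreover have "1 \<in> thickening L R W"
    using thickening_contains assms unfolding subframe_def by blast
  ultimately show ?thesis
    unfolding subframe_def by auto
qed

text \<open>
  The condition on \<open>d\<close> over which \<open>VDI_star A V\<close> takes its supremum, apart from \<open>d > 0\<close>.
\<close>

definition isoperimetric :: "'a set \<Rightarrow> 'a set \<Rightarrow> real \<Rightarrow> bool" where
  "isoperimetric A V d \<longleftrightarrow>
     (\<exists>C>0. \<forall>W. subframe A W \<longrightarrow>
        real (max (dim (span_prod V W)) (dim (span_prod W V)))
          \<ge> real (dim W) + C * real (dim W) powr ((d - 1) / d))"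

end

text \<open>The exponent \<open>(d - 1) / d\<close> is negative when \<open>d < 1\<close>, which is why \<open>y\<close> is bounded from both
  sides.\<close>

lemma powr_comparable_lower_bound:
  fixes x y N p :: real
  assumes "0 \<le> x" "x \<le> y" "y \<le> N * x" "1 \<le> N"
  shows "min 1 (N powr p) * x powr p \<le> y powr p"
proof (cases "x = 0")
  case True
  then show ?thesis by simp
next
  case False
  then have "0 < x" using assms by simp
  show ?thesis
  proof (cases "0 \<le> p")
    case True
    have "min 1 (N powr p) * x powr p \<le> 1 * x powr p"
      by (intro mult_right_mono) auto
    also have "\<dots> \<le> y powr p"
      using True assms by (simp add: powr_mono2)
    finally show ?thesis .
  next
    case False
    have "min 1 (N powr p) * x powr p \<le> N powr p * x powr p"
      by (intro mult_right_mono) auto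
    also have "\<dots> = (N * x) powr p"
      using assms by (simp add: powr_mult)
    also have "\<dots> \<le> y powr p"
      using False assms \<open>0 < x\<close> by (intro powr_mono2') auto
    finally show ?thesis .
  qed
qed

context k_algebra
begin

text \<open>
  The inequality for \<open>V\<close> at the thickening of \<open>W\<close>, divided by \<open>N = card L * card R\<close>, is the one for
  \<open>V'\<close> at \<open>W\<close>, once the power of the dimension of the thickening is compared with that of
  \<open>dim W\<close>.
\<close>

lemma isoperimetric_descends:
  assumes fin: "finite L" "finite R" and one: "1 \<in> L" "1 \<in> R"
    and V': "subframe E V'"
    and VL: "span_prod V L \<subseteq> span_prod L V'"
    and RV: "span_prod R V \<subseteq> span_prod V' R"
    and iso: "isoperimetric UNIV V d"
  shows "isoperimetric E V' d"
proof -
  obtain C where C: "C > 0"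
    and ineq: "\<And>W. subframe UNIV W \<Longrightarrow>
      real (dim W) + C * real (dim W) powr ((d - 1) / d)
        \<le> real (max (dim (span_prod V W)) (dim (span_prod W V)))"
    using iso unfolding isoperimetric_def by blast
  define N where "N = card L * card R"
  define p where "p = (d - 1) / d"
  define c where "c = C * min 1 (real N powr p) / real N"
  have N: "1 \<le> N"
    using fin one unfolding N_def by (auto simp: Suc_le_eq card_gt_0_iff)
  have "0 < c"
    using C N unfolding c_def by simp
  moreover have "real (dim W) + c * real (dim W) powr p
      \<le> real (max (dim (span_prod V' W)) (dim (span_prod W V')))" if W: "subframe E W" for W
  proof -
    let ?T = "thickening L R W"
    let ?m = "max (dim (span_prod V' W)) (dim (span_prod W V'))"
    have T: "subframe UNIV ?T"
      using subframe_thickening[OF fin one W] .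
    obtain G where G: "finite G" "W = span G"
      using W unfolding subframe_def by metis
    obtain H where H: "finite H" "?T = span H"
      using T unfolding subframe_def by metis
    have lower: "dim W \<le> dim ?T"
      using thickening_contains[OF one, of W] H(1)
      unfolding H(2) by (intro dim_mono_finitely_spanned[of _ _ H]) (simp_all add: span_span)
    have upper: "dim ?T \<le> N * dim W"
      unfolding N_def using dim_thickening_le[OF fin G(1), of W] G(2) by simp
    have "1 \<in> V'"
      using V' unfolding subframe_def by auto
    obtain F where F: "finite F" "V' = span F"
      using V' unfolding subframe_def by metis
    obtain S where S: "finite S" "span_prod V' W = span S"
      unfolding F(2) G(2) using span_prod_finitely_spanned[OF F(1) G(1)] .
    \<comment> \<open>Needed because the growth is a truncated difference of natural numbers.\<close>
    have "dim W \<le> dim (span_prod V' W)"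
      using span_prod_contains_right[OF \<open>1 \<in> V'\<close>, of W] S(1)
      unfolding S(2) by (intro dim_mono_finitely_spanned[of _ _ S]) (simp_all add: span_span)
    then have m: "dim W \<le> ?m"
      by simp
    have growth_mono: "dim ?T + N * (a - dim W) \<le> dim ?T + N * (?m - dim W)" if "a \<le> ?m" for a
      using that by (intro add_left_mono mult_left_mono diff_le_mono) simp_all
    have "max (dim (span_prod V ?T)) (dim (span_prod ?T V)) \<le> dim ?T + N * (?m - dim W)"
      using dim_thickening_product_growth[OF fin V' W VL RV, folded N_def] growth_mono
      by (meson max.boundedI max.cobounded1 max.cobounded2 order_trans)
    with ineq[OF T] have "C * real (dim ?T) powr p \<le> real (N * (?m - dim W))"
      unfolding p_def by linarith
    moreover have "min 1 (real N powr p) * real (dim W) powr p \<le> real (dim ?T) powr p"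
      using lower upper N
      by (intro powr_comparable_lower_bound) (auto simp flip: of_nat_mult)
    then have "C * (min 1 (real N powr p) * real (dim W) powr p) \<le> C * real (dim ?T) powr p"
      using C by simp
    ultimately have "C * min 1 (real N powr p) * real (dim W) powr p
        \<le> real N * (real ?m - real (dim W))"
      using m by (simp add: mult.assoc)
    then have "c * real (dim W) powr p \<le> real ?m - real (dim W)"
      using N unfolding c_def by (simp add: field_simps)
    then show ?thesis
      by simp
  qed
  ultimately show ?thesis
    unfolding isoperimetric_def p_def by blast
qed

lemma Ld_star_le_if_isoperimetric_descends:
  assumes "\<And>V. subframe A V \<Longrightarrow>
    \<exists>V'. subframe E V' \<and> (\<forall>d>0. isoperimetric A V d \<longrightarrow> isoperimetric E V' d)"
  shows "Ld_star A \<le> Ld_star E"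
proof -
  have "VDI_star A V \<le> Ld_star E" if V: "subframe A V" for V
  proof -
    obtain V' where V': "subframe E V'" "\<forall>d>0. isoperimetric A V d \<longrightarrow> isoperimetric E V' d"
      using assms[OF V] by blast
    then have "VDI_star A V \<le> VDI_star E V'"
      unfolding VDI_star_def isoperimetric_def[symmetric] by (intro Sup_subset_mono) blast
    also have "\<dots> \<le> Ld_star E"
      unfolding Ld_star_def using V'(1) by (intro Sup_upper) blast
    finally show ?thesis .
  qed
  then show ?thesis
    unfolding Ld_star_def[of A] by (intro Sup_least) auto
qed

end

section \<open>Finite-dimensional extensions\<close>

text \<open>
  Adjoining \<open>1\<close> to the spanning sets makes every \<open>W\<close> a subset of its thickening.
\<close>

lemma left_finite_dimensional_span_prod:
  assumes "k_algebra scale" "left_finite_dimensional E"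
  obtains R where "finite R" "1 \<in> R" "k_algebra.span_prod scale E R = UNIV"
proof -
  interpret k_algebra scale by fact
  obtain B where B: "finite B" "\<And>x. \<exists>c. (\<forall>b\<in>B. c b \<in> E) \<and> x = (\<Sum>b\<in>B. c b * b)"
    using assms(2) unfolding left_finite_dimensional_def by blast
  have "x \<in> span_prod E (insert 1 B)" for x
    using B(2)[of x] by (auto intro!: subspace_sum[OF subspace_span_prod] span_prodI)
  with B(1) show thesis
    by (intro that[of "insert 1 B"]) auto
qed

lemma right_finite_dimensional_span_prod:
  assumes "k_algebra scale" "right_finite_dimensional E"
  obtains L where "finite L" "1 \<in> L" "k_algebra.span_prod scale L E = UNIV"
proof -
  interpret k_algebra scale by fact
  obtain B where B: "finite B" "\<And>x. \<exists>c. (\<forall>b\<in>B. c b \<in> E) \<and> x = (\<Sum>b\<in>B. b * c b)"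
    using assms(2) unfolding right_finite_dimensional_def by blast
  have "x \<in> span_prod (insert 1 B) E" for x
    using B(2)[of x] by (auto intro!: subspace_sum[OF subspace_span_prod] span_prodI)
  with B(1) show thesis
    by (intro that[of "insert 1 B"]) auto
qed

theorem proposition3p3:
  fixes scale :: "'k::field \<Rightarrow> 'd::division_ring \<Rightarrow> 'd"
    and E :: "'d set"
  assumes "k_algebra scale"
    and "division_subalgebra scale E"
    and "left_finite_dimensional E"
    and "right_finite_dimensional E"
  shows "k_algebra.Ld_star scale UNIV \<le> k_algebra.Ld_star scale E"
proof -
  interpret k_algebra scale by fact
  have E: "subspace E" "1 \<in> E"
    using assms(2) unfolding division_subalgebra_def by auto
  obtain R where R: "finite R" "1 \<in> R" "span_prod E R = UNIV"
    using left_finite_dimensional_span_prod[OF assms(1,3)] .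
  obtain L where L: "finite L" "1 \<in> L" "span_prod L E = UNIV"
    using right_finite_dimensional_span_prod[OF assms(1,4)] .
  show ?thesis
  proof (rule Ld_star_le_if_isoperimetric_descends)
    fix V assume "subframe UNIV V"
    then obtain V' where "subframe E V'" "span_prod V L \<subseteq> span_prod L V'"
      "span_prod R V \<subseteq> span_prod V' R"
      using subframe_of_coefficients[OF E L(1,3) R(1,3)] by metis
    then show "\<exists>V'. subframe E V' \<and> (\<forall>d>0. isoperimetric UNIV V d \<longrightarrow> isoperimetric E V' d)"
      using isoperimetric_descends[OF L(1) R(1) L(2) R(2)] by blast
  qed
qed

end
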